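(* Let $m\ge 1$ and let $\mathcal{G}=(V,\mathcal{E})$ be an undirected $(m+1)$-uniform hypergraph with $|V|=n\ge 2$ and sparsity $s$. Then the algebraic connectivity $a(\mathcal{G})$ and the vertex connectivity $v(\mathcal{G})$ satisfy $$a(\mathcal{G})\le (2m-1)\,s\,v(\mathcal{G}).$$
   Context: An undirected $(m+1)$-uniform hypergraph $\mathcal{G}=(V,\mathcal{E})$ consists of a finite vertex set $V=\{v_1,\dots,v_n\}$ and a set $\mathcal{E}$ of $(m+1)$-element subsets of $V$ (hyperedges). Adjacency tensor: $\mathcal{A}=(a_{i_1,\dots,i_{m+1}})$, indices in $\{1,\dots,n\}$, with $a_{i_1,\dots,i_{m+1}}=\frac{1}{m!}$ if $\{v_{i_1},\dots,v_{i_{m+1}}\}\in\mathcal{E}$ (so the indices are distinct) and $0$ otherwise. For $x\in\mathbb{R}^n$ and an $(m+1)$th order $n$-dimensional real tensor $\mathcal{B}$, $x^\top\mathcal{B}\in\mathbb{R}^{1\times n}$ is defined by $(x^\top\mathcal{B})_j=\sum_{t,i_1,\dots,i_m=1}^n x_t\, b_{i_1,\dots,i_m,j}\,\delta(t\in\{i_1,\dots,i_m\})$, where $\delta(p)=1$ if $p$ is true and $0$ otherwise; and $x^\top\mathcal{B}x=\sum_j (x^\top\mathcal{B})_j x_j$. Degrees: $(d_1,\dots,d_n)=\mathbf{1}^\top\mathcal{A}$, where $\mathbf{1}$ is the all-ones vector. Laplacian tensor: $\mathcal{L}=\mathcal{D}-\mathcal{A}$, where $\mathcal{D}$ is the diagonal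 tensor with $\mathcal{D}_{i,\dots,i}=d_i$ and all other entries $0$. Algebraic connectivity: $a(\mathcal{G})=\min\{x^\top\mathcal{L}x : x\in\mathbb{R}^n,\ x\perp\mathbf{1},\ \|x\|_2=1\}$. Sparsity: $s=\max_{v_i\neq v_j}|\{E\in\mathcal{E}: v_i,v_j\in E\}|$. Connectivity: $\mathcal{G}$ is connected if for every two vertices $u,w$ there are hyperedges $E_1,\dots,E_l$ with $u\in E_1$, $w\in E_l$ and $E_i\cap E_{i+1}\ne\emptyset$ for all $i<l$. For $W\subseteq V$, $\mathcal{G}(V\setminus W)$ is the hypergraph obtained by deleting the vertices of $W$ and all hyperedges meeting $W$. Vertex connectivity: $v(\mathcal{G})=\min\{|W| : W\subset V,\ \mathcal{G}(V\setminus W)\text{ is not connected}\}$ (read as $+\infty$ if there is no such $W$). *)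

theory Defs
  imports "HOL-Analysis.Analysis" "HOL-Library.Extended_Nat" "HOL-Library.Extended_Real"
begin

record 'v hypergraph =
  verts :: "'v set"
  edges :: "'v set set"

definition uniform_hypergraph :: "nat \<Rightarrow> 'v hypergraph \<Rightarrow> bool" where
  "uniform_hypergraph k G \<longleftrightarrow>
     finite (verts G) \<and> (\<forall>e\<in>edges G. e \<subseteq> verts G \<and> card e = k)"

text \<open>An \<open>n\<close>-dimensional tensor of order \<open>k\<close> is encoded by its entries at the index lists of
  length \<open>k\<close>, the indices being the elements of a finite type with \<open>n\<close> elements; entries at lists
  of any other length are irrelevant. For a hypergraph tensor the indices are the vertices
  themselves, so these definitions concern hypergraphs whose vertex set is the whole type.\<close>

type_synonym 'n tensor = "'n list \<Rightarrow> real"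

text \<open>The row vector \<open>x\<^sup>T B\<close> for a tensor \<open>B\<close> of order \<open>m + 1\<close>. The free index \<open>j\<close> is the
  last one.\<close>

definition vec_tensor :: "nat \<Rightarrow> real ^ 'n \<Rightarrow> 'n tensor \<Rightarrow> real ^ 'n" where
  "vec_tensor m x B =
     (\<chi> j. \<Sum>t\<in>UNIV. \<Sum>is\<in>{is. length is = m}. x $ t * B (is @ [j]) * of_bool (t \<in> set is))"

definition tensor_form :: "nat \<Rightarrow> 'n tensor \<Rightarrow> real ^ 'n \<Rightarrow> real" where
  "tensor_form m B x = (\<Sum>j\<in>UNIV. vec_tensor m x B $ j * x $ j)"

text \<open>For an \<open>(m + 1)\<close>-uniform hypergraph and an index list of length \<open>m + 1\<close>, the condition below
  forces the indices to be distinct.\<close>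

definition adjacency_tensor :: "nat \<Rightarrow> 'n::finite hypergraph \<Rightarrow> 'n tensor" where
  "adjacency_tensor m G is = (if set is \<in> edges G then 1 / fact m else 0)"

definition degree_vec :: "nat \<Rightarrow> 'n::finite hypergraph \<Rightarrow> real ^ 'n" where
  "degree_vec m G = vec_tensor m 1 (adjacency_tensor m G)"

definition diagonal_tensor :: "nat \<Rightarrow> real ^ 'n::finite \<Rightarrow> 'n tensor" where
  "diagonal_tensor m d is = (if is = replicate (m + 1) (hd is) then d $ hd is else 0)"

definition laplacian_tensor :: "nat \<Rightarrow> 'n::finite hypergraph \<Rightarrow> 'n tensor" where
  "laplacian_tensor m G is = diagonal_tensor m (degree_vec m G) is - adjacency_tensor m G is"

text \<open>The infimum is attained if \<open>n \<ge> 2\<close>; see \<open>algebraic_connectivity_is_minimum\<close>.\<close>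

definition algebraic_connectivity :: "nat \<Rightarrow> 'n::finite hypergraph \<Rightarrow> real" where
  "algebraic_connectivity m G =
     Inf {tensor_form m (laplacian_tensor m G) x | x :: real ^ 'n. orthogonal x 1 \<and> norm x = 1}"

definition sparsity :: "'v hypergraph \<Rightarrow> nat" where
  "sparsity G =
     Max {card {e \<in> edges G. u \<in> e \<and> w \<in> e} | u w. u \<in> verts G \<and> w \<in> verts G \<and> u \<noteq> w}"

text \<open>Only distinct vertices need to be joined: a hypergraph with a single vertex is connected even
  though it may have no hyperedge.\<close>

definition connected_hypergraph :: "'v hypergraph \<Rightarrow> bool" where
  "connected_hypergraph G \<longleftrightarrow>
     (\<forall>u\<in>verts G. \<forall>w\<in>verts G. u \<noteq> w \<longrightarrow>
        (\<exists>es. es \<noteq> [] \<and> set es \<subseteq> edges G \<and> u \<in> hd es \<and> w \<in> last es \<and>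
              (\<forall>i. Suc i < length es \<longrightarrow> es ! i \<inter> es ! Suc i \<noteq> {})))"

definition delete_vertices :: "'v hypergraph \<Rightarrow> 'v set \<Rightarrow> 'v hypergraph" where
  "delete_vertices G W = \<lparr>verts = verts G - W, edges = {e \<in> edges G. e \<inter> W = {}}\<rparr>"

text \<open>In \<^typ>\<open>enat\<close> the infimum of a nonempty set is its minimum, and that of the empty set
  is \<open>\<infinity>\<close>.\<close>

definition vertex_connectivity :: "'v hypergraph \<Rightarrow> enat" where
  "vertex_connectivity G =
     (INF W \<in> {W. W \<subset> verts G \<and> \<not> connected_hypergraph (delete_vertices G W)}. enat (card W))"

lemma algebraic_connectivity_is_minimum:
  fixes G :: "'n::finite hypergraph"
  assumes "CARD('n) \<ge> 2"
  shows "\<exists>x :: real ^ 'n. orthogonal x 1 \<and> norm x = 1 \<and>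
           tensor_form m (laplacian_tensor m G) x = algebraic_connectivity m G \<and>
           (\<forall>y. orthogonal y 1 \<and> norm y = 1 \<longrightarrow>
              algebraic_connectivity m G \<le> tensor_form m (laplacian_tensor m G) y)"
proof -
  let ?f = "tensor_form m (laplacian_tensor m G)"
  let ?S = "{x :: real ^ 'n. orthogonal x 1 \<and> norm x = 1}"
  have S: "?S = sphere 0 1 \<inter> {x. 1 \<bullet> x = 0}"
    by (auto simp: orthogonal_def inner_commute)
  have "compact ?S"
    unfolding S by (intro compact_Int_closed compact_sphere closed_hyperplane)
  moreover have "?S \<noteq> {}"
  proof -
    obtain z :: "real ^ 'n" where "z \<noteq> 0" "orthogonal 1 z"
      using orthogonal_to_vector_exists[of "1 :: real ^ 'n"] assms by auto
    then have "z /\<^sub>R norm z \<in> ?S"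
      by (simp add: orthogonal_def inner_commute)
    then show ?thesis by blast
  qed
  moreover have "continuous_on ?S ?f"
    unfolding tensor_form_def vec_tensor_def by (simp, intro continuous_intros)
  ultimately obtain x where x: "x \<in> ?S" "\<forall>y\<in>?S. ?f x \<le> ?f y"
    using continuous_attains_inf by blast
  have "algebraic_connectivity m G = ?f x"
    unfolding algebraic_connectivity_def using x by (intro cInf_eq_minimum) auto
  then show ?thesis using x by auto
qed

end

theory Submission
  imports Defs "HOL-Combinatorics.Multiset_Permutations"
begin

text \<open>
  The Laplacian form is that of a weighted graph: each hyperedge contributes
  \<open>(x\<^sub>i - x\<^sub>j)\<^sup>2\<close> for every pair of its vertices, so that \<open>x\<^sup>T L x\<close> is the sum, over all pairs
  \<open>{i, j}\<close> of vertices, of \<open>(x\<^sub>i - x\<^sub>j)\<^sup>2\<close> times the number of hyperedges that contain both (lemma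
  \<open>tensor_form_laplacian\<close>). For distinct vertices this number is at most the sparsity \<open>s\<close>.

  Now let \<open>W\<close>, with \<open>k\<close> vertices, be such that its deletion disconnects the hypergraph into
  nonempty parts \<open>A\<close> and \<open>B\<close>, with \<open>a\<close> and \<open>b\<close> vertices. As for graphs, the test vector is \<open>b\<close> on
  \<open>A\<close>, \<open>- a\<close> on \<open>B\<close> and \<open>0\<close> on \<open>W\<close>; it is orthogonal to the all-ones vector and has squared norm
  \<open>a b (a + b)\<close>. Pairs between \<open>W\<close> and its complement contribute at most
  \<open>s k (a b\<^sup>2 + b a\<^sup>2) = s k a b (a + b)\<close>.

  Unlike in a graph, a pair may also join \<open>A\<close> to \<open>B\<close>, but only inside a hyperedge that meets \<open>W\<close>.
  Such a hyperedge has at most \<open>m - 1\<close> vertices in \<open>B\<close>, because it has one in \<open>A\<close> and one in \<open>W\<close>.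
  So a vertex of \<open>A\<close> is joined to \<open>B\<close> by total weight at most \<open>(m - 1) s k\<close> (lemma
  \<open>sum_codegree_across_le\<close>), and by symmetry the total weight between \<open>A\<close> and \<open>B\<close> is at most
  \<open>(m - 1) s k min(a, b)\<close>. Each such pair contributes \<open>(a + b)\<^sup>2\<close>, and \<open>min(a, b) (a + b) \<le> 2 a b\<close>,
  so they add at most \<open>2 (m - 1) s k a b (a + b)\<close>. Division by the squared norm gives
  \<open>(2 m - 1) s k\<close>.
\<close>

section \<open>Codegrees\<close>

definition codegree :: "'v hypergraph \<Rightarrow> 'v \<Rightarrow> 'v \<Rightarrow> nat" where
  "codegree G u w = card {e \<in> edges G. u \<in> e \<and> w \<in> e}"

lemma codegree_commute: "codegree G u w = codegree G w u"
  by (simp add: codegree_def conj_commute)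

lemma uniform_hypergraph_finite_edges:
  assumes "uniform_hypergraph k G"
  shows "finite (edges G)"
proof (rule finite_subset)
  show "edges G \<subseteq> Pow (verts G)" and "finite (Pow (verts G))"
    using assms by (auto simp: uniform_hypergraph_def)
qed

lemma codegree_le_sparsity:
  assumes "finite (verts G)" "u \<in> verts G" "w \<in> verts G" "u \<noteq> w"
  shows "codegree G u w \<le> sparsity G"
proof -
  let ?S = "{card {e \<in> edges G. u \<in> e \<and> w \<in> e} | u w. u \<in> verts G \<and> w \<in> verts G \<and> u \<noteq> w}"
  have "?S \<subseteq> (\<lambda>(u, w). codegree G u w) ` (verts G \<times> verts G)"
    by (auto simp: codegree_def)
  then have "finite ?S"
    using assms(1) by (meson finite_SigmaI finite_imageI finite_subset)
  moreover have "codegree G u w \<in> ?S"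
    using assms by (auto simp: codegree_def)
  ultimately show ?thesis
    unfolding sparsity_def by (rule Max_ge)
qed

text \<open>Double counting of the pairs of a hyperedge through \<open>u\<close> and a vertex of \<open>S\<close> on it.\<close>

lemma sum_codegree:
  assumes "finite (edges G)" "finite S"
  shows "(\<Sum>v\<in>S. codegree G u v) = (\<Sum>e\<in>{e \<in> edges G. u \<in> e}. card (e \<inter> S))"
proof -
  have "(\<Sum>v\<in>S. codegree G u v)
      = (\<Sum>v\<in>S. \<Sum>e\<in>{e \<in> edges G. u \<in> e}. if v \<in> e then 1 else 0)"
    using assms(1) by (simp add: codegree_def sum.If_cases Int_def conj_assoc)
  also have "\<dots> = (\<Sum>e\<in>{e \<in> edges G. u \<in> e}. \<Sum>v\<in>S. if v \<in> e then 1 else 0)"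
    by (rule sum.swap)
  also have "\<dots> = (\<Sum>e\<in>{e \<in> edges G. u \<in> e}. card (e \<inter> S))"
    using assms(2) by (simp add: sum.If_cases Int_commute)
  finally show ?thesis .
qed

section \<open>The Laplacian form\<close>

text \<open>These index lists are the ones at which the tuple sum defining entry \<open>j\<close> of
  \<open>x\<^sup>T A\<close> picks up \<open>x\<^sub>t\<close>. They are the enumerations of the sets \<open>e - {j}\<close>, where \<open>e\<close> is a
  hyperedge through \<open>t\<close> and \<open>j\<close>; the factor \<open>m!\<close> cancels the normalisation of the adjacency
  tensor.\<close>

lemma card_edge_lists:
  fixes G :: "'n::finite hypergraph"
  assumes "uniform_hypergraph (m + 1) G"
  shows "card {is. length is = m \<and> insert j (set is) \<in> edges G \<and> t \<in> set is}
       = (if t = j then 0 else fact m * codegree G t j)"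
proof -
  let ?L = "{is. length is = m \<and> insert j (set is) \<in> edges G \<and> t \<in> set is}"
  let ?E = "{e \<in> edges G. t \<in> e \<and> j \<in> e}"
  \<comment> \<open>The \<open>m\<close> entries together with \<open>j\<close> have to fill a hyperedge of size \<open>m + 1\<close>.\<close>
  have distinct: "distinct is \<and> j \<notin> set is" if "is \<in> ?L" for "is"
  proof -
    have "card (insert j (set is)) = m + 1"
      using that assms by (auto simp: uniform_hypergraph_def)
    moreover have "card (set is) \<le> m"
      using that card_length by auto
    ultimately show ?thesis
      using that by (auto simp: card_insert_if card_distinct split: if_splits)
  qed
  show ?thesis
  proof (cases "t = j")
    case True
    then have "?L = {}" using distinct by blast
    then have "card ?L = 0" by (simp only: card.empty)
    then show ?thesis using True by simp
  next
    case False
    have "?L = (\<Union>e\<in>?E. permutations_of_set (e - {j}))"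
    proof (intro equalityI subsetI)
      fix "is" assume *: "is \<in> ?L"
      then show "is \<in> (\<Union>e\<in>?E. permutations_of_set (e - {j}))"
        using distinct[OF *] by (auto simp: permutations_of_set_def intro!: bexI[of _ "insert j (set is)"])
    next
      fix "is" assume "is \<in> (\<Union>e\<in>?E. permutations_of_set (e - {j}))"
      then obtain e where e: "e \<in> edges G" "t \<in> e" "j \<in> e" "set is = e - {j}" "distinct is"
        by (auto simp: permutations_of_set_def)
      have "length is = card (e - {j})"
        using e by (metis distinct_card)
      also have "\<dots> = m"
        using e assms by (simp add: uniform_hypergraph_def)
      finally show "is \<in> ?L"
        using e False by (simp add: insert_absorb)
    qed
    also have "card \<dots> = (\<Sum>e\<in>?E. card (permutations_of_set (e - {j})))"
    proof (rule card_UN_disjoint)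
      show "\<forall>e\<in>?E. \<forall>f\<in>?E. e \<noteq> f \<longrightarrow>
          permutations_of_set (e - {j}) \<inter> permutations_of_set (f - {j}) = {}"
        by (auto simp: permutations_of_set_def)
    qed auto
    also have "\<dots> = (\<Sum>e\<in>?E. fact m)"
      using assms by (intro sum.cong) (auto simp: uniform_hypergraph_def)
    finally show ?thesis
      using False by (simp add: codegree_def mult.commute)
  qed
qed

lemma vec_tensor_adjacency:
  fixes G :: "'n::finite hypergraph"
  assumes "uniform_hypergraph (m + 1) G"
  shows "vec_tensor m x (adjacency_tensor m G) $ j
       = (\<Sum>t\<in>UNIV. (if t = j then 0 else real (codegree G t j)) * x $ t)"
proof -
  have fin: "finite {is :: 'n list. length is = m}"
    using finite_lists_length_eq[of "UNIV :: 'n set" m] by simp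
  have "(\<Sum>is\<in>{is. length is = m}. x $ t * adjacency_tensor m G (is @ [j]) * of_bool (t \<in> set is))
      = (if t = j then 0 else real (codegree G t j)) * x $ t" for t
  proof -
    have "(\<Sum>is\<in>{is. length is = m}. x $ t * adjacency_tensor m G (is @ [j]) * of_bool (t \<in> set is))
        = (\<Sum>is\<in>{is. length is = m}.
             if insert j (set is) \<in> edges G \<and> t \<in> set is then x $ t / fact m else 0)"
      by (intro sum.cong) (auto simp: adjacency_tensor_def)
    also have "\<dots> = real (card {is. length is = m \<and> insert j (set is) \<in> edges G \<and> t \<in> set is})
                   * (x $ t / fact m)"
      using fin by (simp add: sum.If_cases Int_def)
    also have "\<dots> = (if t = j then 0 else real (codegree G t j)) * x $ t"
      unfolding card_edge_lists[OF assms] by simp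
    finally show ?thesis .
  qed
  then show ?thesis by (simp add: vec_tensor_def)
qed

text \<open>The condition \<open>m \<ge> 1\<close> excludes the empty index list, at which no \<open>t\<close> contributes.\<close>

lemma vec_tensor_diagonal:
  fixes d x :: "real ^ 'n::finite"
  assumes "m \<ge> 1"
  shows "vec_tensor m x (diagonal_tensor m d) $ j = d $ j * x $ j"
proof -
  have fin: "finite {is :: 'n list. length is = m}"
    using finite_lists_length_eq[of "UNIV :: 'n set" m] by simp
  have diag: "diagonal_tensor m d (is @ [j]) = (if is = replicate m j then d $ j else 0)"
    if len: "length is = m" for "is"
  proof -
    obtain i ks where "is": "is = i # ks"
      using len assms by (cases "is") auto
    have "is @ [j] = replicate (m + 1) i \<longleftrightarrow> is @ [j] = replicate m i @ [i]"
      by (simp add: replicate_append_same)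
    also have "\<dots> \<longleftrightarrow> is = replicate m j \<and> i = j"
      by auto
    also have "\<dots> \<longleftrightarrow> is = replicate m j"
      using "is" assms by (cases m) auto
    finally show ?thesis
      using "is" assms by (cases m) (auto simp: diagonal_tensor_def)
  qed
  have "(\<Sum>is\<in>{is. length is = m}. x $ t * diagonal_tensor m d (is @ [j]) * of_bool (t \<in> set is))
      = (if t = j then d $ j * x $ j else 0)" for t
  proof -
    have "(\<Sum>is\<in>{is. length is = m}. x $ t * diagonal_tensor m d (is @ [j]) * of_bool (t \<in> set is))
        = (\<Sum>is\<in>{is. length is = m}. if replicate m j = is then if t = j then d $ j * x $ j else 0 else 0)"
    proof (intro sum.cong refl)
      fix "is" :: "'n list" assume "is \<in> {is. length is = m}"
      then show "x $ t * diagonal_tensor m d (is @ [j]) * of_bool (t \<in> set is)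
          = (if replicate m j = is then if t = j then d $ j * x $ j else 0 else 0)"
        using assms by (cases "is = replicate m j") (simp_all add: diag)
    qed
    also have "\<dots> = (if t = j then d $ j * x $ j else 0)"
      using fin by (subst sum.delta') auto
    finally show ?thesis .
  qed
  then show ?thesis by (simp add: vec_tensor_def)
qed

text \<open>Entry \<open>j\<close> of the degree vector is the total codegree of \<open>j\<close> with the other vertices, hence the
  form is the usual Laplacian form of the graph weighted by codegrees. The sum runs over ordered
  pairs, which accounts for the factor one half; the diagonal codegrees, which the adjacency tensor
  does not see, are multiplied by zero.\<close>

lemma tensor_form_laplacian:
  fixes G :: "'n::finite hypergraph"
  assumes "m \<ge> 1" "uniform_hypergraph (m + 1) G"
  shows "tensor_form m (laplacian_tensor m G) x
       = (\<Sum>i\<in>UNIV. \<Sum>j\<in>UNIV. real (codegree G i j) * (x $ i - x $ j)\<^sup>2) / 2"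
proof -
  define c where "c i j = (if i = j then 0 else real (codegree G i j))" for i j
  have c_commute: "c i j = c j i" for i j
    by (simp add: c_def codegree_commute)
  have adj: "vec_tensor m y (adjacency_tensor m G) $ j = (\<Sum>t\<in>UNIV. c t j * y $ t)" for y j
    using vec_tensor_adjacency[OF assms(2)] by (simp add: c_def)
  have deg: "degree_vec m G $ j = (\<Sum>t\<in>UNIV. c t j)" for j
    by (simp add: degree_vec_def adj)
  have "vec_tensor m x (laplacian_tensor m G) $ j
      = vec_tensor m x (diagonal_tensor m (degree_vec m G)) $ j
        - vec_tensor m x (adjacency_tensor m G) $ j" for j
    by (simp add: vec_tensor_def laplacian_tensor_def right_diff_distrib left_diff_distrib
        sum_subtractf)
  then have "vec_tensor m x (laplacian_tensor m G) $ j = (\<Sum>t\<in>UNIV. c j t * (x $ j - x $ t))" for j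
    by (simp add: vec_tensor_diagonal[OF assms(1)] adj deg sum_distrib_right sum_subtractf
        right_diff_distrib c_commute[of _ j])
  then have L: "tensor_form m (laplacian_tensor m G) x
      = (\<Sum>i\<in>UNIV. \<Sum>j\<in>UNIV. c i j * (x $ i * x $ i - x $ i * x $ j))"
    by (simp add: tensor_form_def sum_distrib_left left_diff_distrib right_diff_distrib ac_simps)
  \<comment> \<open>Exchanging the two indices and averaging produces the squares.\<close>
  also have "\<dots> = (\<Sum>i\<in>UNIV. \<Sum>j\<in>UNIV. c i j * (x $ j * x $ j - x $ i * x $ j))"
    by (subst sum.swap) (intro sum.cong refl, simp add: c_commute mult.commute)
  finally have "2 * tensor_form m (laplacian_tensor m G) x
      = (\<Sum>i\<in>UNIV. \<Sum>j\<in>UNIV. c i j * (x $ i * x $ i - x $ i * x $ j))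
        + (\<Sum>i\<in>UNIV. \<Sum>j\<in>UNIV. c i j * (x $ j * x $ j - x $ i * x $ j))"
    using L by simp
  also have "\<dots> = (\<Sum>i\<in>UNIV. \<Sum>j\<in>UNIV. c i j * (x $ i - x $ j)\<^sup>2)"
    by (simp add: sum.distrib[symmetric] power2_eq_square algebra_simps)
  also have "\<dots> = (\<Sum>i\<in>UNIV. \<Sum>j\<in>UNIV. real (codegree G i j) * (x $ i - x $ j)\<^sup>2)"
    by (intro sum.cong) (auto simp: c_def)
  finally show ?thesis by simp
qed

lemma algebraic_connectivity_le_Rayleigh:
  fixes G :: "'n::finite hypergraph"
  assumes "CARD('n) \<ge> 2" "m \<ge> 1" "uniform_hypergraph (m + 1) G" "orthogonal x 1"
  shows "algebraic_connectivity m G * (norm x)\<^sup>2 \<le> tensor_form m (laplacian_tensor m G) x"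
proof (cases "x = 0")
  case True
  then show ?thesis by (simp add: tensor_form_def)
next
  case False
  let ?y = "x /\<^sub>R norm x"
  have "algebraic_connectivity m G \<le> tensor_form m (laplacian_tensor m G) ?y"
    using algebraic_connectivity_is_minimum[OF assms(1), of m G] assms(4) False
    by (auto simp: orthogonal_def)
  also have "\<dots> = tensor_form m (laplacian_tensor m G) x / (norm x)\<^sup>2"
  proof -
    have "?y $ i - ?y $ j = (x $ i - x $ j) / norm x" for i j
      by (simp add: divide_inverse algebra_simps)
    then show ?thesis
      unfolding tensor_form_laplacian[OF assms(2,3)]
      by (simp add: power_divide sum_divide_distrib mult.commute)
  qed
  finally show ?thesis
    using False by (simp add: field_simps)
qed

section \<open>Separators\<close>

text \<open>The part \<open>A\<close> is the component of a vertex \<open>u\<close> that cannot reach some other vertex. Chains of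
  hyperedges are nonempty, so \<open>u\<close> itself has to be put into \<open>A\<close> explicitly: it may lie on no
  hyperedge.\<close>

lemma disconnected_partition:
  assumes "\<not> connected_hypergraph H"
  obtains A B where "A \<union> B = verts H" "A \<inter> B = {}" "A \<noteq> {}" "B \<noteq> {}"
    and "\<And>e. e \<in> edges H \<Longrightarrow> e \<inter> A = {} \<or> e \<inter> B = {}"
proof -
  define chain where "chain es u w \<longleftrightarrow> es \<noteq> [] \<and> set es \<subseteq> edges H \<and> u \<in> hd es \<and> w \<in> last es \<and>
      (\<forall>i. Suc i < length es \<longrightarrow> es ! i \<inter> es ! Suc i \<noteq> {})" for es u w
  obtain u w where uw: "u \<in> verts H" "w \<in> verts H" "u \<noteq> w" "\<And>es. \<not> chain es u w"
    using assms unfolding connected_hypergraph_def chain_def by blast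
  define A where "A = {v \<in> verts H. v = u \<or> (\<exists>es. chain es u v)}"
  have "e \<inter> A = {} \<or> e \<inter> (verts H - A) = {}" if e: "e \<in> edges H" for e
  proof (rule ccontr)
    assume "\<not> ?thesis"
    then obtain a b where a: "a \<in> e" "a \<in> A" and b: "b \<in> e" "b \<in> verts H" "b \<notin> A"
      by blast
    have "\<exists>es. chain es u b"
    proof (cases "a = u")
      case True
      then have "chain [e] u b" using a b e by (simp add: chain_def)
      then show ?thesis ..
    next
      case False
      then obtain es where es: "chain es u a" using a by (auto simp: A_def)
      have "(es @ [e]) ! i \<inter> (es @ [e]) ! Suc i \<noteq> {}" if "Suc i < length (es @ [e])" for i
      proof (cases "Suc i < length es")
        case True
        then show ?thesis using es by (simp add: chain_def nth_append)
      next
        case False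
        then have i: "Suc i = length es" using that by simp
        then have "es ! i = last es"
          using es by (metis chain_def diff_Suc_1 last_conv_nth)
        then show ?thesis
          using es a i by (auto simp: chain_def nth_append)
      qed
      then have "chain (es @ [e]) u b" using es b e by (auto simp: chain_def)
      then show ?thesis ..
    qed
    then show False using b by (auto simp: A_def)
  qed
  moreover have "u \<in> A" "w \<in> verts H - A"
    using uw by (auto simp: A_def)
  moreover have "A \<subseteq> verts H" by (auto simp: A_def)
  ultimately show thesis
    using that[of A "verts H - A"] by blast
qed

text \<open>A hyperedge through \<open>u\<close> that meets \<open>B\<close> also meets \<open>W\<close>, so besides \<open>u\<close> and a vertex of \<open>W\<close> it has
  room for only \<open>m - 1\<close> vertices of \<open>B\<close>. Thus \<open>\<bar>e \<inter> B\<bar> \<le> (m - 1) \<bar>e \<inter> W\<bar>\<close> holds for each hyperedge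
  \<open>e\<close> through \<open>u\<close>, and it remains to sum over these hyperedges.\<close>

lemma sum_codegree_across_le:
  assumes "uniform_hypergraph (m + 1) G" "m \<ge> 1"
    and "u \<in> A" "A \<union> B \<union> W \<subseteq> verts G" "A \<inter> B = {}" "A \<inter> W = {}" "B \<inter> W = {}"
    and sep: "\<And>e. e \<in> edges G \<Longrightarrow> e \<inter> W = {} \<Longrightarrow> e \<inter> A = {} \<or> e \<inter> B = {}"
  shows "(\<Sum>v\<in>B. codegree G u v) \<le> (m - 1) * (\<Sum>w\<in>W. codegree G u w)"
proof -
  have fin: "finite (edges G)" "finite B" "finite W"
    using assms(1,4) uniform_hypergraph_finite_edges[OF assms(1)]
    by (auto simp: uniform_hypergraph_def intro: finite_subset)
  have "card (e \<inter> B) \<le> (m - 1) * card (e \<inter> W)" if e: "e \<in> edges G" "u \<in> e" for e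
  proof (cases "e \<inter> B = {}")
    case False
    then obtain w where w: "w \<in> e \<inter> W"
      using sep[OF e(1)] e assms(3) by blast
    have e': "finite e" "card e = m + 1"
      using assms(1) e by (auto simp: uniform_hypergraph_def intro: finite_subset)
    have "card (e \<inter> B) \<le> card (e - {u, w})"
      using e' w assms by (intro card_mono) auto
    also have "\<dots> = m - 1"
    proof -
      have "u \<noteq> w" using w assms(3,6) by auto
      then show ?thesis using e e' w by (subst card_Diff_subset) auto
    qed
    also have "\<dots> \<le> (m - 1) * card (e \<inter> W)"
      using w e' by (cases "card (e \<inter> W)") auto
    finally show ?thesis .
  qed simp
  then show ?thesis
    unfolding sum_codegree[OF fin(1,2)] sum_codegree[OF fin(1,3)] sum_distrib_left
    by (intro sum_mono) auto
qed

lemma sum_blocks: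
  fixes F :: "'n::finite \<Rightarrow> 'n \<Rightarrow> real"
  assumes "A \<union> B \<union> W = UNIV" "A \<inter> B = {}" "A \<inter> W = {}" "B \<inter> W = {}"
    and sym: "\<And>i j. F i j = F j i"
    and zero: "\<And>i j S. S \<in> {A, B, W} \<Longrightarrow> i \<in> S \<Longrightarrow> j \<in> S \<Longrightarrow> F i j = 0"
  shows "(\<Sum>i\<in>UNIV. \<Sum>j\<in>UNIV. F i j)
       = 2 * ((\<Sum>i\<in>A. \<Sum>j\<in>B. F i j) + (\<Sum>i\<in>A. \<Sum>j\<in>W. F i j) + (\<Sum>i\<in>B. \<Sum>j\<in>W. F i j))"
proof -
  have split: "sum g UNIV = sum g A + sum g B + sum g W" for g :: "'n \<Rightarrow> real"
    using assms(1-4) by (subst assms(1)[symmetric], subst sum.union_disjoint)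
      (auto simp: sum.union_disjoint)
  have swap: "(\<Sum>i\<in>S. \<Sum>j\<in>T. F i j) = (\<Sum>i\<in>T. \<Sum>j\<in>S. F i j)" for S T
    by (subst sum.swap) (simp add: sym)
  have diag: "(\<Sum>i\<in>S. \<Sum>j\<in>S. F i j) = 0" if "S \<in> {A, B, W}" for S
    using zero[OF that] by simp
  show ?thesis
    using swap[of B A] swap[of W A] swap[of W B] diag[of A] diag[of B] diag[of W]
    by (simp add: split sum.distrib)
qed

text \<open>The bound comes from the Rayleigh quotient of the vector that is zero on the separator and
  constant on each side of it, with the constants chosen to make the entries sum to zero.\<close>

lemma algebraic_connectivity_le_separator:
  fixes G :: "'n::finite hypergraph"
  assumes "m \<ge> 1" "CARD('n) \<ge> 2" "verts G = UNIV" "uniform_hypergraph (m + 1) G"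
    and "\<not> connected_hypergraph (delete_vertices G W)"
  shows "algebraic_connectivity m G \<le> (2 * real m - 1) * real (sparsity G) * real (card W)"
proof -
  obtain A B where AB: "A \<union> B = - W" "A \<inter> B = {}" "A \<noteq> {}" "B \<noteq> {}"
    and sep: "\<And>e. e \<in> edges G \<Longrightarrow> e \<inter> W = {} \<Longrightarrow> e \<inter> A = {} \<or> e \<inter> B = {}"
  proof (rule disconnected_partition[OF assms(5)])
    fix A B
    assume "A \<union> B = verts (delete_vertices G W)" "A \<inter> B = {}" "A \<noteq> {}" "B \<noteq> {}"
      and "\<And>e. e \<in> edges (delete_vertices G W) \<Longrightarrow> e \<inter> A = {} \<or> e \<inter> B = {}"
    then show thesis
      using assms(3) by (intro that[of A B]) (simp_all add: delete_vertices_def Compl_eq_Diff_UNIV)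
  qed
  have AW: "A \<inter> W = {}" and BW: "B \<inter> W = {}" and UN: "A \<union> B \<union> W = UNIV"
    using AB(1) by auto
  define a where "a = real (card A)"
  define b where "b = real (card B)"
  define K where "K = real (sparsity G) * real (card W)"
  have pos: "a > 0" "b > 0" "K \<ge> 0"
    using AB by (auto simp: a_def b_def K_def card_gt_0_iff)
  define x :: "real ^ 'n" where
    "x = (\<chi> i. if i \<in> A then b else if i \<in> B then - a else 0)"
  have xA: "x $ i = b" if "i \<in> A" for i using that by (simp add: x_def)
  have xB: "x $ i = - a" if "i \<in> B" for i using that AB(2) by (auto simp: x_def)
  have xW: "x $ i = 0" if "i \<in> W" for i using that AW BW by (auto simp: x_def)
  have split: "sum g UNIV = sum g A + sum g B + sum g W" for g :: "'n \<Rightarrow> real"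
    using AB(2) AW BW by (subst UN[symmetric], subst sum.union_disjoint)
      (auto simp: sum.union_disjoint)

  have orth: "orthogonal x 1"
    by (simp add: orthogonal_def inner_vec_def split xA xB xW a_def b_def)
  have norm: "(norm x)\<^sup>2 = a * b * (a + b)"
    unfolding power2_norm_eq_inner
    by (simp add: inner_vec_def split xA xB xW flip: a_def b_def) (simp add: algebra_simps)

  have sW: "(\<Sum>w\<in>W. real (codegree G u w)) \<le> K" if "u \<notin> W" for u
  proof -
    have "(\<Sum>w\<in>W. real (codegree G u w)) \<le> (\<Sum>w\<in>W. real (sparsity G))"
      using that assms(3) by (intro sum_mono of_nat_mono codegree_le_sparsity) auto
    then show ?thesis by (simp add: K_def mult.commute)
  qed
  have across: "(\<Sum>v\<in>T. real (codegree G u v)) \<le> (real m - 1) * K"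
    if "u \<in> S" "(S, T) = (A, B) \<or> (S, T) = (B, A)" for u S T
  proof -
    have "(\<Sum>v\<in>T. codegree G u v) \<le> (m - 1) * (\<Sum>w\<in>W. codegree G u w)"
    proof (rule sum_codegree_across_le[OF assms(4,1) that(1)])
      show "e \<inter> S = {} \<or> e \<inter> T = {}" if "e \<in> edges G" "e \<inter> W = {}" for e
        using sep[OF that] \<open>(S, T) = (A, B) \<or> (S, T) = (B, A)\<close> by auto
    qed (use that(2) AB(2) AW BW assms(3) in auto)
    then have "(\<Sum>v\<in>T. real (codegree G u v)) \<le> real (m - 1) * (\<Sum>w\<in>W. real (codegree G u w))"
      by (metis of_nat_le_iff of_nat_mult of_nat_sum)
    also have "\<dots> \<le> real (m - 1) * K"
      using that AW BW by (intro mult_left_mono sW) auto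
    finally show ?thesis using assms(1) by (simp add: of_nat_diff)
  qed
  define X where "X = (\<Sum>i\<in>A. \<Sum>j\<in>B. real (codegree G i j))"
  have XA: "X \<le> a * ((real m - 1) * K)"
    unfolding X_def a_def using across[of _ A B] by (intro sum_bounded_above) auto
  have "X = (\<Sum>i\<in>B. \<Sum>j\<in>A. real (codegree G i j))"
    unfolding X_def by (subst sum.swap) (simp add: codegree_commute)
  then have XB: "X \<le> b * ((real m - 1) * K)"
    using across[of _ B A] unfolding b_def by (simp add: sum_bounded_above)
  \<comment> \<open>Weighting the two bounds by \<open>b\<close> and \<open>a\<close> respectively makes their right-hand sides equal and
    replaces the estimate \<open>min(a, b) (a + b) \<le> 2 a b\<close>.\<close>
  have "X * b \<le> (real m - 1) * K * (a * b)"
    using mult_right_mono[OF XA, of b] pos by (simp add: ac_simps)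
  moreover have "X * a \<le> (real m - 1) * K * (a * b)"
    using mult_right_mono[OF XB, of a] pos by (simp add: ac_simps)
  ultimately have X: "X * (a + b) \<le> 2 * (real m - 1) * K * (a * b)"
    unfolding distrib_left by linarith

  have toW: "(\<Sum>i\<in>S. \<Sum>j\<in>W. real (codegree G i j)) \<le> real (card S) * K" if "S \<inter> W = {}" for S
    using that by (intro sum_bounded_above sW) auto
  have "algebraic_connectivity m G * (a * b * (a + b))
      \<le> tensor_form m (laplacian_tensor m G) x"
    using algebraic_connectivity_le_Rayleigh[OF assms(2,1,4) orth] by (simp add: norm)
  also have "\<dots> = (\<Sum>i\<in>A. \<Sum>j\<in>B. real (codegree G i j) * (x $ i - x $ j)\<^sup>2)
      + (\<Sum>i\<in>A. \<Sum>j\<in>W. real (codegree G i j) * (x $ i - x $ j)\<^sup>2)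
      + (\<Sum>i\<in>B. \<Sum>j\<in>W. real (codegree G i j) * (x $ i - x $ j)\<^sup>2)"
    unfolding tensor_form_laplacian[OF assms(1,4)]
    by (subst sum_blocks[OF UN AB(2) AW BW])
      (auto simp: codegree_commute power2_commute xA xB xW)
  also have "\<dots> = X * (a + b)\<^sup>2 + (\<Sum>i\<in>A. \<Sum>j\<in>W. real (codegree G i j)) * b\<^sup>2
      + (\<Sum>i\<in>B. \<Sum>j\<in>W. real (codegree G i j)) * a\<^sup>2"
    by (simp add: X_def sum_distrib_right xA xB xW add.commute)
  also have "\<dots> \<le> 2 * (real m - 1) * K * (a * b) * (a + b) + (a * K) * b\<^sup>2 + (b * K) * a\<^sup>2"
    using mult_right_mono[OF X, of "a + b"] toW[OF AW] toW[OF BW] pos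
    by (intro add_mono mult_right_mono) (auto simp: power2_eq_square a_def b_def mult.assoc)
  also have "\<dots> = (2 * real m - 1) * K * (a * b * (a + b))"
    by (simp add: algebra_simps power2_eq_square)
  finally show ?thesis
    using pos by (simp add: K_def mult.assoc)
qed

lemma Inf_enat_mem: "S \<noteq> {} \<Longrightarrow> Inf S \<in> S" for S :: "enat set"
  unfolding Inf_enat_def by (auto intro: LeastI)

lemma vertex_connectivity_attained:
  assumes "vertex_connectivity G = enat k"
  obtains W where "card W = k" "\<not> connected_hypergraph (delete_vertices G W)"
proof -
  let ?S = "(\<lambda>W. enat (card W)) ` {W. W \<subset> verts G \<and> \<not> connected_hypergraph (delete_vertices G W)}"
  have "?S \<noteq> {}"
    using assms by (auto simp: vertex_connectivity_def Inf_enat_def split: if_splits)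
  then have "Inf ?S \<in> ?S"
    by (rule Inf_enat_mem)
  then show thesis
    using assms that by (auto simp: vertex_connectivity_def)
qed

theorem theorem4p2:
  fixes m :: nat and G :: "'n::finite hypergraph"
  assumes "m \<ge> 1"
    and "CARD('n) \<ge> 2"
    and "verts G = UNIV"
    and "uniform_hypergraph (m + 1) G"
  shows "ereal (algebraic_connectivity m G)
           \<le> ereal ((2 * real m - 1) * real (sparsity G)) * ereal_of_enat (vertex_connectivity G)"
proof (cases "vertex_connectivity G")
  case (enat k)
  then obtain W where "card W = k" "\<not> connected_hypergraph (delete_vertices G W)"
    by (rule vertex_connectivity_attained)
  then show ?thesis
    using algebraic_connectivity_le_separator[OF assms] enat by auto
next
  case infinity
  \<comment> \<open>The right-hand side is infinite unless the sparsity is zero, because \<open>0 * \<infinity> = 0\<close> for extended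
    reals. But a hypergraph without separators is itself connected, hence has a hyperedge, which
    contains two vertices.\<close>
  have "connected_hypergraph (delete_vertices G {})"
  proof (rule ccontr)
    assume "\<not> ?thesis"
    then have "vertex_connectivity G \<le> enat (card ({} :: 'n set))"
      unfolding vertex_connectivity_def using assms(3) by (intro INF_lower) auto
    then show False using infinity by simp
  qed
  then have conn: "connected_hypergraph G"
    by (simp add: connected_hypergraph_def delete_vertices_def)
  obtain u w :: 'n where "u \<noteq> w"
    using ex_card[OF assms(2)] by (auto simp: card_2_iff)
  then obtain es where "es \<noteq> []" "set es \<subseteq> edges G"
    using conn assms(3) unfolding connected_hypergraph_def by blast
  then have e: "hd es \<in> edges G" by auto
  then have "2 \<le> card (hd es)"
    using assms(1,4) by (auto simp: uniform_hypergraph_def)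
  then obtain p q where pq: "p \<in> hd es" "q \<in> hd es" "p \<noteq> q"
    using ex_card[of 2 "hd es"] by (auto simp: card_2_iff)
  have "0 < codegree G p q"
    using e pq by (auto simp: codegree_def card_gt_0_iff)
  also have "\<dots> \<le> sparsity G"
    using pq assms(3) by (intro codegree_le_sparsity) auto
  finally have "sparsity G > 0" .
  moreover define C where "C = (2 * real m - 1) * real (sparsity G)"
  ultimately have "C > 0"
    using assms(1) by (simp add: zero_less_mult_iff)
  then show ?thesis
    unfolding C_def[symmetric] using infinity by simp
qed

end
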